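(* Let $d\ge 1$, let $\underline u<\overline u$ be real numbers, and let $G\in C^3([\underline u,\overline u])$ satisfy $G'\ge 0$ on $[\underline u,\overline u]$ and $$\frac{d-1}{4}(G'')^2\le -G^{(3)}G'\quad\text{on }[\underline u,\overline u].$$ Let $u\in C^3(\overline Q)$ be a solution of $$u_t=\Delta G(u)\quad\text{in }Q,\qquad u(x,0)=u_0(x)\quad\text{for }x\in\mathbb{T}^d,$$ such that, for some $M>0$ and for all $t\ge 0$, $$\underline u\le u(\cdot,t)\le\overline u\quad\text{and}\quad\|Du(\cdot,t)\|_{L^\infty(\mathbb{T}^d)}\le M.$$ Then for all $t\ge 0$ $$\min_{\mathbb{T}^d}u_0\le u(\cdot,t)\le\max_{\mathbb{T}^d}u_0\quad\text{and}\quad\|Du(\cdot,t)\|_{L^\infty(\mathbb{T}^d)}\le\|Du_0\|_{L^\infty(\mathbb{T}^d)}.$$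
   Context: $\mathbb{T}^d=(\mathbb{R}/\mathbb{Z})^d$ is the $d$-dimensional torus, $Q:=\mathbb{T}^d\times(0,+\infty)$ and $\overline Q=\mathbb{T}^d\times[0,+\infty)$. $Du$ is the gradient of $u$ in the space variable $x$, and $\Delta$ is the Laplacian in $x$, so $\Delta G(u)=G'(u)\Delta u+G''(u)|Du|^2$. $\|Du(\cdot,t)\|_{L^\infty(\mathbb{T}^d)}$ is the supremum over $x\in\mathbb{T}^d$ of the Euclidean norm $|Du(x,t)|$. *)

theory Defs
  imports "HOL-Analysis.Analysis"
begin

text \<open>
  Functions on the torus are represented by their lifts to \<open>real ^ 'd\<close>, i.e. by functions that
  are invariant under translation by each standard basis vector (equivalently, by the lattice of
  integer vectors).
\<close>

definition torus_periodic :: "(real ^ 'd \<Rightarrow> 'b) \<Rightarrow> bool" where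
  "torus_periodic f \<longleftrightarrow> (\<forall>x i. f (x + axis i 1) = f x)"

text \<open>
  \<open>C_k_on k f S\<close>: \<open>f\<close> is of class \<open>C\<^sup>k\<close> on \<open>S\<close>, with derivatives taken relative to \<open>S\<close>, hence up
  to the boundary when \<open>S\<close> is closed. It is used for \<open>{a..b}\<close> with \<open>a < b\<close> and for a closed
  half-space; these are convex with nonempty interior, so the derivative \<open>f'\<close> is unique on \<open>S\<close>.
  The iterated derivatives are handled through their directional values \<open>\<lambda>x. f' x v\<close>.
\<close>

primrec C_k_on :: "nat \<Rightarrow> ('a::euclidean_space \<Rightarrow> real) \<Rightarrow> 'a set \<Rightarrow> bool" where
  "C_k_on 0 f S \<longleftrightarrow> continuous_on S f"
| "C_k_on (Suc k) f S \<longleftrightarrow>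
     (\<exists>f'. (\<forall>x\<in>S. (f has_derivative f' x) (at x within S)) \<and> (\<forall>v. C_k_on k (\<lambda>x. f' x v) S))"

text \<open>One-sided at the end points of an interval \<open>S\<close>; iterate with \<open>^^\<close> for higher derivatives.\<close>

definition deriv_on :: "real set \<Rightarrow> (real \<Rightarrow> real) \<Rightarrow> real \<Rightarrow> real" where
  "deriv_on S f s = vector_derivative f (at s within S)"

definition partial :: "'d \<Rightarrow> (real ^ 'd \<Rightarrow> real) \<Rightarrow> real ^ 'd \<Rightarrow> real" where
  "partial i f x = deriv (\<lambda>h. f (x + h *\<^sub>R axis i 1)) 0"

definition gradient :: "(real ^ 'd \<Rightarrow> real) \<Rightarrow> real ^ 'd \<Rightarrow> real ^ 'd" where
  "gradient f x = (\<chi> i. partial i f x)"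

definition laplacian :: "(real ^ 'd \<Rightarrow> real) \<Rightarrow> real ^ 'd \<Rightarrow> real" where
  "laplacian f x = (\<Sum>i\<in>UNIV. partial i (partial i f) x)"

text \<open>
  The real supremum is only meaningful for bounded sets; for a periodic \<open>C\<^sup>1\<close> function the gradient
  is continuous and periodic, hence bounded.
\<close>

definition grad_sup_norm :: "(real ^ 'd \<Rightarrow> real) \<Rightarrow> real" where
  "grad_sup_norm f = (SUP x. norm (gradient f x))"

end

theory Submission
  imports Defs
begin

text \<open>
  Bernstein's method. If the time derivative of a periodic function is nonpositive at every spatial
  maximum point, its spatial maximum does not increase. At a maximum point of \<open>\<plusminus>u\<close> the equation
  directly gives the sign of \<open>u\<^sub>t\<close>. At a maximum point of \<open>w = |Du|\<^sup>2\<close> one has \<open>D\<^sup>2u Du = 0\<close> and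
  \<open>Du \<cdot> D\<Delta>u \<le> - |D\<^sup>2u|\<^sup>2\<close>, so the differentiated equation yields
  \<open>w\<^sub>t / 2 \<le> - G' |D\<^sup>2u|\<^sup>2 + G'' w \<Delta>u + G''' w\<^sup>2\<close>. If \<open>Du \<noteq> 0\<close>, then \<open>Du\<close> is a null vector of
  \<open>D\<^sup>2u\<close>, so \<open>(\<Delta>u)\<^sup>2 \<le> (d - 1) |D\<^sup>2u|\<^sup>2\<close>, and the hypothesis on \<open>G\<close> is the discriminant condition
  for the resulting quadratic form to be nonpositive.
\<close>

section \<open>Directional derivatives\<close>

text \<open>The direction is an arbitrary vector of the domain, so on space-time pairs the same
  notion covers \<open>partial\<close> (direction \<open>(axis j 1, 0)\<close>) and the time
  derivative (direction \<open>(0, 1)\<close>); symmetry of second derivatives then covers mixed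
  space-time derivatives.\<close>

definition ddir :: "'a \<Rightarrow> ('a::real_normed_vector \<Rightarrow> real) \<Rightarrow> 'a \<Rightarrow> real" where
  "ddir v f z = deriv (\<lambda>h. f (z + h *\<^sub>R v)) 0"

lemma C_k_on_subset: "C_k_on k f S \<Longrightarrow> T \<subseteq> S \<Longrightarrow> C_k_on k f T"
proof (induction k arbitrary: f)
  case 0
  then show ?case by (auto intro: continuous_on_subset)
next
  case (Suc k)
  then obtain f' where "\<forall>x\<in>S. (f has_derivative f' x) (at x within S)" "\<forall>v. C_k_on k (\<lambda>x. f' x v) S"
    by auto
  with Suc show ?case
    by (auto intro!: exI[of _ f'] intro: has_derivative_subset)
qed

lemma C_k_on_cong: "C_k_on k f S \<Longrightarrow> (\<And>x. x \<in> S \<Longrightarrow> f x = g x) \<Longrightarrow> C_k_on k g S"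
proof (cases k)
  case 0
  then show "C_k_on k f S \<Longrightarrow> (\<And>x. x \<in> S \<Longrightarrow> f x = g x) \<Longrightarrow> C_k_on k g S"
    by (auto cong: continuous_on_cong)
next
  case (Suc k')
  assume "C_k_on k f S" and eq: "\<And>x. x \<in> S \<Longrightarrow> f x = g x"
  with Suc obtain f' where f': "\<forall>x\<in>S. (f has_derivative f' x) (at x within S)"
    "\<forall>v. C_k_on k' (\<lambda>x. f' x v) S"
    by auto
  have "(g has_derivative f' x) (at x within S)" if "x \<in> S" for x
    using has_derivative_transform[OF that, of g f "f' x"] f' eq that by auto
  with f' Suc show "C_k_on k g S" by auto
qed

lemma C_k_on_imp_continuous_on: "C_k_on k f S \<Longrightarrow> continuous_on S f"
  by (cases k) (auto intro: has_derivative_continuous_on)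

lemma C_k_on_Suc_D: "C_k_on (Suc k) f S \<Longrightarrow> C_k_on k f S"
proof (induction k arbitrary: f)
  case 0
  then show ?case using C_k_on_imp_continuous_on[OF 0] by simp
next
  case (Suc k)
  then obtain f' where f': "\<forall>x\<in>S. (f has_derivative f' x) (at x within S)" "\<forall>v. C_k_on (Suc k) (\<lambda>x. f' x v) S"
    using C_k_on.simps(2) by blast
  with Suc.IH have "\<forall>v. C_k_on k (\<lambda>x. f' x v) S" by blast
  with f'(1) show ?case unfolding C_k_on.simps(2) by blast
qed

lemma C_k_on_mono: "C_k_on k f S \<Longrightarrow> j \<le> k \<Longrightarrow> C_k_on j f S"
  by (induction k) (auto simp: le_Suc_eq simp del: C_k_on.simps dest: C_k_on_Suc_D)

text \<open>If the line through \<open>z\<close> stays in \<open>S\<close> for small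
  \<open>h\<close>, then 0 is interior to the set of admissible \<open>h\<close>, and the derivative
  relative to \<open>S\<close> becomes an ordinary two-sided derivative in \<open>h\<close>. This
  also works at boundary points of a half-space, for directions parallel to the boundary.\<close>

lemma has_derivative_along_line:
  fixes f :: "'a::real_normed_vector \<Rightarrow> real"
  assumes "(f has_derivative f') (at z within S)" "z \<in> S"
    and ev: "eventually (\<lambda>h. z + h *\<^sub>R v \<in> S) (nhds 0)"
  shows "DERIV (\<lambda>h. f (z + h *\<^sub>R v)) 0 :> f' v"
proof -
  let ?A = "{h. z + h *\<^sub>R v \<in> S}"
  have "((\<lambda>h. z + h *\<^sub>R v) has_derivative (\<lambda>h. h *\<^sub>R v)) (at 0 within ?A)"
    by (auto intro!: derivative_eq_intros)
  moreover have "(f has_derivative f') (at (z + 0 *\<^sub>R v) within (\<lambda>h. z + h *\<^sub>R v) ` ?A)"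
    using assms(1) by (auto intro: has_derivative_subset)
  ultimately have "((\<lambda>h. f (z + h *\<^sub>R v)) has_derivative (\<lambda>h. f' (h *\<^sub>R v))) (at 0 within ?A)"
    by (rule has_derivative_in_compose)
  moreover have "at 0 within ?A = at 0"
  proof -
    from ev obtain T where "open T" "0 \<in> T" "\<forall>h\<in>T. h \<in> ?A"
      unfolding eventually_nhds by auto
    then have "0 \<in> interior ?A" by (auto simp: interior_def)
    then show ?thesis by (rule at_within_interior)
  qed
  moreover have "(\<lambda>h. f' (h *\<^sub>R v)) = (*) (f' v)"
    using linear_scale[OF has_derivative_linear[OF assms(1)]] by (auto simp: mult.commute)
  ultimately show ?thesis by (simp add: has_field_derivative_def)
qed

lemma ddir_unique: "DERIV (\<lambda>h. f (z + h *\<^sub>R v)) 0 :> D \<Longrightarrow> ddir v f z = D"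
  unfolding ddir_def by (rule DERIV_imp_deriv)

lemma eventually_line_in_open:
  fixes z v :: "'a::real_normed_vector"
  assumes "open S" "z \<in> S"
  shows "eventually (\<lambda>h. z + h *\<^sub>R v \<in> S) (nhds 0)"
proof -
  have "open ((\<lambda>h. z + h *\<^sub>R v) -` S)"
    by (rule open_vimage[OF assms(1)]) (intro continuous_intros)
  with assms(2) show ?thesis
    unfolding eventually_nhds by (intro exI[of _ "(\<lambda>h. z + h *\<^sub>R v) -` S"]) auto
qed

lemma C_k_on_Suc_DERIV_ddir:
  assumes "C_k_on (Suc k) f S" "z \<in> S" "eventually (\<lambda>h. z + h *\<^sub>R v \<in> S) (nhds 0)"
  shows "DERIV (\<lambda>h. f (z + h *\<^sub>R v)) 0 :> ddir v f z"
proof -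
  obtain f' where "\<forall>x\<in>S. (f has_derivative f' x) (at x within S)"
    using assms(1) by auto
  with has_derivative_along_line[OF _ assms(2,3), of f "f' z"] assms(2)
  have "DERIV (\<lambda>h. f (z + h *\<^sub>R v)) 0 :> f' z v" by auto
  with ddir_unique[OF this] show ?thesis by simp
qed

text \<open>The condition concerns the direction \<open>v\<close> rather than openness of
  \<open>S\<close>, so spatial derivatives on the closed half-space keep their regularity up to time
  0.\<close>

lemma C_k_on_ddir:
  assumes "C_k_on (Suc k) f S" and ev: "\<And>z. z \<in> S \<Longrightarrow> eventually (\<lambda>h. z + h *\<^sub>R v \<in> S) (nhds 0)"
  shows "C_k_on k (ddir v f) S"
proof -
  obtain f' where f': "\<forall>x\<in>S. (f has_derivative f' x) (at x within S)" "\<forall>v. C_k_on k (\<lambda>x. f' x v) S"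
    using assms(1) by auto
  have "f' z v = ddir v f z" if "z \<in> S" for z
    using ddir_unique[OF has_derivative_along_line[OF _ that ev[OF that], of f "f' z"]] that f'(1)
    by simp
  with C_k_on_cong[OF f'(2)[rule_format, of v]] show ?thesis by blast
qed

lemma C_k_on_open_DERIV:
  assumes "C_k_on (Suc k) f S" "open S" "z + s *\<^sub>R v \<in> S"
  shows "DERIV (\<lambda>h. f (z + h *\<^sub>R v)) s :> ddir v f (z + s *\<^sub>R v)"
proof -
  have "DERIV (\<lambda>h. f ((z + s *\<^sub>R v) + h *\<^sub>R v)) 0 :> ddir v f (z + s *\<^sub>R v)"
    using assms eventually_line_in_open by (intro C_k_on_Suc_DERIV_ddir)
  then have "DERIV (\<lambda>h. f (z + (h + s) *\<^sub>R v)) 0 :> ddir v f (z + s *\<^sub>R v)"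
    by (simp add: algebra_simps)
  then show ?thesis
    using DERIV_shift[of "\<lambda>h. f (z + h *\<^sub>R v)" _ 0 s] by simp
qed

text \<open>The mean value theorem is used twice: along \<open>v\<close> for the increment of
  \<open>f\<close> in direction \<open>w\<close>, then along \<open>w\<close> for
  \<open>ddir v f\<close>.\<close>

lemma double_difference_mvt:
  fixes f :: "'a::euclidean_space \<Rightarrow> real"
  assumes f: "C_k_on 2 f S" and "open S" and "h > 0"
    and sub: "\<And>a b. 0 \<le> a \<Longrightarrow> a \<le> h \<Longrightarrow> 0 \<le> b \<Longrightarrow> b \<le> h \<Longrightarrow> z + a *\<^sub>R v + b *\<^sub>R w \<in> S"
  obtains a b where "0 \<le> a" "a \<le> h" "0 \<le> b" "b \<le> h"
    "f (z + h *\<^sub>R v + h *\<^sub>R w) - f (z + h *\<^sub>R v) - f (z + h *\<^sub>R w) + f z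
      = h * h * ddir w (ddir v f) (z + a *\<^sub>R v + b *\<^sub>R w)"
proof -
  have f2: "C_k_on (Suc 1) f S" using f by (simp add: numeral_2_eq_2)
  then have f1: "C_k_on (Suc 0) (ddir v f) S"
    using C_k_on_ddir[of 1 f S v] eventually_line_in_open[OF \<open>open S\<close>] by auto
  define \<phi> where "\<phi> s = f ((z + h *\<^sub>R w) + s *\<^sub>R v) - f (z + s *\<^sub>R v)" for s
  have 1: "DERIV \<phi> s :> ddir v f ((z + h *\<^sub>R w) + s *\<^sub>R v) - ddir v f (z + s *\<^sub>R v)"
    if "0 \<le> s" "s \<le> h" for s
    unfolding \<phi>_def
    using sub[of s 0] sub[of s h] that \<open>h > 0\<close>
    by (intro DERIV_diff C_k_on_open_DERIV[OF f2 \<open>open S\<close>]) (auto simp: algebra_simps)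
  obtain a where a: "0 < a" "a < h"
    "\<phi> h - \<phi> 0 = (h - 0) * (ddir v f ((z + h *\<^sub>R w) + a *\<^sub>R v) - ddir v f (z + a *\<^sub>R v))"
    using MVT2[OF \<open>h > 0\<close> 1] by blast
  have 2: "DERIV (\<lambda>s. ddir v f ((z + a *\<^sub>R v) + s *\<^sub>R w)) s :> ddir w (ddir v f) ((z + a *\<^sub>R v) + s *\<^sub>R w)"
    if "0 \<le> s" "s \<le> h" for s
    using a sub[of a s] that by (intro C_k_on_open_DERIV[OF f1 \<open>open S\<close>]) auto
  obtain b where b: "0 < b" "b < h"
    "ddir v f ((z + a *\<^sub>R v) + h *\<^sub>R w) - ddir v f ((z + a *\<^sub>R v) + 0 *\<^sub>R w)
      = (h - 0) * ddir w (ddir v f) ((z + a *\<^sub>R v) + b *\<^sub>R w)"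
    using MVT2[OF \<open>h > 0\<close> 2] by blast
  show thesis
  proof (rule that[of a b])
    have "f (z + h *\<^sub>R v + h *\<^sub>R w) - f (z + h *\<^sub>R v) - f (z + h *\<^sub>R w) + f z = \<phi> h - \<phi> 0"
      by (simp add: \<phi>_def algebra_simps)
    also have "\<dots> = h * (h * ddir w (ddir v f) ((z + a *\<^sub>R v) + b *\<^sub>R w))"
      using a(3) b(3) by (simp add: algebra_simps)
    finally show "f (z + h *\<^sub>R v + h *\<^sub>R w) - f (z + h *\<^sub>R v) - f (z + h *\<^sub>R w) + f z
      = h * h * ddir w (ddir v f) (z + a *\<^sub>R v + b *\<^sub>R w)" by simp
  qed (use a b in auto)
qed

text \<open>Schwarz's theorem: the double difference is symmetric in \<open>v\<close> and
  \<open>w\<close>, so the two mixed derivatives agree at some pair of points close to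
  \<open>z\<close>, and continuity carries this over to \<open>z\<close>.\<close>

lemma ddir_commute:
  fixes f :: "'a::euclidean_space \<Rightarrow> real"
  assumes f: "C_k_on 2 f S" and "open S" and "z \<in> S"
  shows "ddir v (ddir w f) z = ddir w (ddir v f) z"
proof (rule ccontr)
  assume neq: "ddir v (ddir w f) z \<noteq> ddir w (ddir v f) z"
  \<comment> \<open>Half the supposed gap: two errors below \<open>e\<close> cannot bridge
    it.\<close>
  define e where "e = \<bar>ddir v (ddir w f) z - ddir w (ddir v f) z\<bar> / 2"
  have "e > 0" using neq by (simp add: e_def)
  have f2: "C_k_on (Suc (Suc 0)) f S" using f by (simp add: numeral_2_eq_2)
  have cont: "continuous_on S (ddir v' (ddir w' f))" for v' w'
    using C_k_on_ddir[OF C_k_on_ddir[OF f2]] eventually_line_in_open[OF \<open>open S\<close>] by simp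
  have cont': "eventually (\<lambda>y. dist (ddir v' (ddir w' f) y) (ddir v' (ddir w' f) z) < e) (nhds z)" for v' w'
  proof -
    have "isCont (ddir v' (ddir w' f)) z"
      using cont[of v' w'] \<open>z \<in> S\<close> by (simp add: continuous_on_eq_continuous_at[OF \<open>open S\<close>])
    then have "((ddir v' (ddir w' f)) \<longlongrightarrow> ddir v' (ddir w' f) z) (nhds z)"
      by (simp add: isCont_def tendsto_at_iff_tendsto_nhds)
    then show ?thesis using \<open>e > 0\<close> by (rule tendstoD)
  qed
  have "eventually (\<lambda>y. y \<in> S \<and> dist (ddir v (ddir w f) y) (ddir v (ddir w f) z) < e
      \<and> dist (ddir w (ddir v f) y) (ddir w (ddir v f) z) < e) (nhds z)"
    using cont'[of v w] cont'[of w v] eventually_nhds_in_open[OF \<open>open S\<close> \<open>z \<in> S\<close>]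
    by eventually_elim auto
  then obtain r where "r > 0" and r: "\<And>y. dist y z < r \<Longrightarrow> y \<in> S \<and> dist (ddir v (ddir w f) y) (ddir v (ddir w f) z) < e
      \<and> dist (ddir w (ddir v f) y) (ddir w (ddir v f) z) < e"
    unfolding eventually_nhds_metric by blast
  \<comment> \<open>With this size the parallelogram spanned by \<open>h *\<^sub>R v\<close> and
    \<open>h *\<^sub>R w\<close> stays within \<open>r / 2\<close> of \<open>z\<close>; the summand
    1 keeps the denominator positive when both vectors vanish.\<close>
  define h where "h = r / (2 * (norm v + norm w + 1))"
  have pos: "norm v + norm w + 1 > 0"
    by (smt (verit) norm_ge_zero)
  have "h > 0" using \<open>r > 0\<close> pos by (simp add: h_def)
  have near: "dist (z + a *\<^sub>R v + b *\<^sub>R w) z < r" if "0 \<le> a" "a \<le> h" "0 \<le> b" "b \<le> h" for a b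
  proof -
    have "dist (z + a *\<^sub>R v + b *\<^sub>R w) z = norm (a *\<^sub>R v + b *\<^sub>R w)"
      by (simp add: dist_norm algebra_simps)
    also have "\<dots> \<le> a * norm v + b * norm w"
      using norm_triangle_ineq[of "a *\<^sub>R v" "b *\<^sub>R w"] that by simp
    also have "\<dots> \<le> h * norm v + h * norm w"
      using that by (intro add_mono mult_right_mono) auto
    also have "\<dots> \<le> h * (norm v + norm w + 1)"
      using \<open>h > 0\<close> by (simp add: algebra_simps)
    also have "\<dots> = r / 2" using pos by (simp add: h_def field_simps)
    also have "\<dots> < r" using \<open>r > 0\<close> by simp
    finally show ?thesis .
  qed
  obtain a b where ab: "0 \<le> a" "a \<le> h" "0 \<le> b" "b \<le> h"
    "f (z + h *\<^sub>R v + h *\<^sub>R w) - f (z + h *\<^sub>R v) - f (z + h *\<^sub>R w) + f z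
      = h * h * ddir w (ddir v f) (z + a *\<^sub>R v + b *\<^sub>R w)"
    using double_difference_mvt[OF f \<open>open S\<close> \<open>h > 0\<close>, of z v w] near r by metis
  have near': "dist (z + a *\<^sub>R w + b *\<^sub>R v) z < r" if "0 \<le> a" "a \<le> h" "0 \<le> b" "b \<le> h" for a b
    using near[of b a] that by (simp add: algebra_simps)
  obtain c d where cd: "0 \<le> c" "c \<le> h" "0 \<le> d" "d \<le> h"
    "f (z + h *\<^sub>R w + h *\<^sub>R v) - f (z + h *\<^sub>R w) - f (z + h *\<^sub>R v) + f z
      = h * h * ddir v (ddir w f) (z + c *\<^sub>R w + d *\<^sub>R v)"
    using double_difference_mvt[OF f \<open>open S\<close> \<open>h > 0\<close>, of z w v] near' r by metis
  have "h * h * ddir w (ddir v f) (z + a *\<^sub>R v + b *\<^sub>R w) = h * h * ddir v (ddir w f) (z + c *\<^sub>R w + d *\<^sub>R v)"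
    using ab(5) cd(5) by (simp add: algebra_simps)
  with \<open>h > 0\<close> have "ddir w (ddir v f) (z + a *\<^sub>R v + b *\<^sub>R w) = ddir v (ddir w f) (z + c *\<^sub>R w + d *\<^sub>R v)"
    by simp
  with r[OF near[OF ab(1-4)]] r[OF near'[OF cd(1-4)]]
  have "\<bar>ddir v (ddir w f) z - ddir w (ddir v f) z\<bar> < 2 * e"
    unfolding dist_real_def by linarith
  then show False by (simp add: e_def)
qed

section \<open>Maximum principle\<close>

text \<open>If \<open>D\<close> were positive, \<open>\<phi>'\<close> would be positive just to the
  right of \<open>a\<close>, and by the mean value theorem \<open>\<phi>\<close> would exceed its
  maximum there.\<close>

lemma DERIV_local_max_second:
  fixes \<phi> :: "real \<Rightarrow> real"
  assumes d1: "\<And>h. DERIV \<phi> h :> \<phi>' h" and d2: "DERIV \<phi>' a :> D" and mx: "\<And>h. \<phi> h \<le> \<phi> a"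
  shows "\<phi>' a = 0" "D \<le> 0"
proof -
  show 0: "\<phi>' a = 0" using DERIV_local_max[OF d1 zero_less_one] mx by blast
  show "D \<le> 0"
  proof (rule ccontr)
    assume "\<not> D \<le> 0"
    then obtain d where d: "d > 0" "\<And>h. 0 < h \<Longrightarrow> h < d \<Longrightarrow> \<phi>' a < \<phi>' (a + h)"
      using DERIV_pos_inc_right[OF d2] by auto
    obtain s where s: "a < s" "s < a + d / 2" "\<phi> (a + d / 2) - \<phi> a = (a + d / 2 - a) * \<phi>' s"
      using MVT2[of a "a + d / 2" \<phi> \<phi>'] d1 d(1) by auto
    have "\<phi>' s > 0" using d(2)[of "s - a"] s(1,2) d(1) 0 by simp
    then have "(a + d / 2 - a) * \<phi>' s > 0" using d(1) by simp
    with mx[of "a + d / 2"] s(3) show False by linarith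
  qed
qed

text \<open>Every value is taken on the unit cube, which supplies the compactness of the torus for
  lifted functions.\<close>

lemma torus_periodic_frac:
  fixes f :: "real ^ 'd \<Rightarrow> 'b"
  assumes "torus_periodic f"
  shows "f (\<chi> i. frac (x $ i)) = f x"
proof -
  have step_nat: "f (y + real n *\<^sub>R axis i 1) = f y" for y i n
  proof (induction n)
    case (Suc n)
    have "y + real (Suc n) *\<^sub>R axis i 1 = (y + real n *\<^sub>R axis i 1) + axis i 1"
      by (simp add: algebra_simps)
    with Suc assms show ?case unfolding torus_periodic_def by metis
  qed simp
  have step: "f (y + of_int n *\<^sub>R axis i 1) = f y" for y i n
  proof (cases "n \<ge> 0")
    case True
    then show ?thesis using step_nat[of y "nat n" i] by simp
  next
    \<comment> \<open>For negative \<open>n\<close> the upward walk of \<open>nat (- n)\<close>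
      steps starts at the shifted point and ends at \<open>y\<close>.\<close>
    case False
    then show ?thesis using step_nat[of "y + of_int n *\<^sub>R axis i 1" "nat (- n)" i] by simp
  qed
  have "f (y + (\<Sum>i\<in>A. of_int (n i) *\<^sub>R axis i 1)) = f y" if "finite A" for y n and A :: "'d set"
    using that
  proof (induction A arbitrary: y)
    case (insert j A)
    then show ?case using step[of "y" "n j" j] by (simp add: add.assoc[symmetric])
  qed simp
  from this[of UNIV "\<chi> i. frac (x $ i)" "\<lambda>i. \<lfloor>x $ i\<rfloor>"]
  have "f ((\<chi> i. frac (x $ i)) + (\<Sum>i\<in>UNIV. of_int \<lfloor>x $ i\<rfloor> *\<^sub>R axis i 1)) = f (\<chi> i. frac (x $ i))"
    by simp
  moreover have "(\<chi> i. frac (x $ i)) + (\<Sum>i\<in>UNIV. of_int \<lfloor>x $ i\<rfloor> *\<^sub>R axis i 1) = x"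
    by (simp add: vec_eq_iff axis_def if_distrib[of "\<lambda>a. _ * a"] frac_def cong: if_cong)
  ultimately show ?thesis by simp
qed

lemma frac_in_unit_cbox: "(\<chi> i. frac (x $ i)) \<in> cbox 0 (1 :: real ^ 'd)"
  by (auto simp: mem_box_cart less_imp_le[OF frac_lt_1])

text \<open>Subtracting \<open>c * t\<close> makes the time derivative strictly negative at a
  spatial maximum, so the penalised function cannot attain its space-time maximum at a positive
  time; then \<open>c\<close> tends to 0. Naming a maximum point \<open>y\<close> of the initial
  slice avoids suprema and their boundedness conditions.\<close>

lemma parabolic_maximum_principle:
  fixes f :: "real ^ 'd \<Rightarrow> real \<Rightarrow> real"
  assumes per: "\<And>t. t \<ge> 0 \<Longrightarrow> torus_periodic (\<lambda>x. f x t)"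
    and cont: "continuous_on (UNIV \<times> {0..}) (\<lambda>(x, t). f x t)"
    and deriv: "\<And>x t. t > 0 \<Longrightarrow> (\<And>y. f y t \<le> f x t) \<Longrightarrow> \<exists>D\<le>0. DERIV (f x) t :> D"
  shows "\<exists>y. \<forall>t\<ge>0. \<forall>x. f x t \<le> f y 0"
proof -
  let ?K = "cbox 0 (1 :: real ^ 'd)"
  have "?K \<noteq> {}" using frac_in_unit_cbox by blast
  have "continuous_on (?K \<times> {0}) (\<lambda>(x, t). f x t)"
    using continuous_on_subset[OF cont, of "?K \<times> {0}"] by auto
  then obtain y where y: "\<And>x. x \<in> ?K \<Longrightarrow> f x 0 \<le> f y 0"
    using continuous_attains_sup[of "?K \<times> {0}" "\<lambda>(x, t). f x t"] \<open>?K \<noteq> {}\<close>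
    by (auto simp: compact_Times)
  have "f x t \<le> f y 0" if "t \<ge> 0" for x t
  proof (rule field_le_epsilon)
    fix e :: real assume "e > 0"
    \<comment> \<open>Chosen so that \<open>c * t \<le> e\<close>, with a positive denominator even
      for \<open>t = 0\<close>.\<close>
    define c where "c = e / (t + 1)"
    have "c > 0" using \<open>e > 0\<close> that by (simp add: c_def)
    let ?g = "\<lambda>p. (case p of (x, t) \<Rightarrow> f x t) - c * snd p"
    have "continuous_on (?K \<times> {0..t}) ?g"
      by (intro continuous_intros continuous_on_subset[OF cont]) auto
    moreover have "compact (?K \<times> {0..t})" by (intro compact_Times) auto
    moreover have "?K \<times> {0..t} \<noteq> {}" using \<open>?K \<noteq> {}\<close> that by auto
    ultimately obtain p where p: "p \<in> ?K \<times> {0..t}" "\<forall>q\<in>?K \<times> {0..t}. ?g q \<le> ?g p"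
      using continuous_attains_sup by blast
    obtain x1 t1 where pe: "p = (x1, t1)" by fastforce
    have x1: "x1 \<in> ?K" and t1: "0 \<le> t1" "t1 \<le> t" using p(1) pe by auto
    \<comment> \<open>Periodicity turns the maximum over the cube into one over the whole space, as
      the hypothesis \<open>deriv\<close> requires.\<close>
    have all: "f y' s - c * s \<le> f x1 t1 - c * t1" if "0 \<le> s" "s \<le> t" for y' s
    proof -
      have "f (\<chi> i. frac (y' $ i)) s = f y' s"
        using torus_periodic_frac[OF per[OF that(1)]] by simp
      moreover have "((\<chi> i. frac (y' $ i)), s) \<in> ?K \<times> {0..t}"
        using frac_in_unit_cbox that by auto
      ultimately show ?thesis using bspec[OF p(2), of "((\<chi> i. frac (y' $ i)), s)"] pe by simp
    qed
    have "t1 = 0"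
    proof (rule ccontr)
      assume "t1 \<noteq> 0"
      with t1 have "t1 > 0" by simp
      have "f y' t1 \<le> f x1 t1" for y' using all[OF t1, of y'] by simp
      then obtain D where D: "D \<le> 0" "DERIV (f x1) t1 :> D"
        using deriv[OF \<open>t1 > 0\<close>] by blast
      have "DERIV (\<lambda>s. f x1 s - c * s) t1 :> D - c"
        using D(2) by (auto intro!: derivative_eq_intros)
      moreover have "D - c < 0" using D \<open>c > 0\<close> by simp
      ultimately obtain d where d: "d > 0"
        "\<And>h. 0 < h \<Longrightarrow> h < d \<Longrightarrow> f x1 t1 - c * t1 < f x1 (t1 - h) - c * (t1 - h)"
        using DERIV_neg_dec_left by blast
      \<comment> \<open>Going back by \<open>h\<close> stays at a nonnegative time and inside the
        range where the penalised function is strictly larger.\<close>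
      define h where "h = min d t1 / 2"
      have "0 < h" "h < d" "h \<le> t1" using d(1) \<open>t1 > 0\<close> by (auto simp: h_def)
      then show False using d(2)[of h] all[of "t1 - h" x1] t1 by auto
    qed
    then have "f x t - c * t \<le> f x1 0" using all[of t x] that by simp
    also have "\<dots> \<le> f y 0" using y x1 by simp
    finally have "f x t \<le> f y 0 + c * t" by simp
    also have "c * t \<le> e" using that \<open>e > 0\<close> by (simp add: c_def field_simps)
    finally show "f x t \<le> f y 0 + e" by simp
  qed
  then show ?thesis by blast
qed

section \<open>The nonlinearity and the Hessian at a maximum point\<close>

lemma deriv_on_Icc:
  assumes "a < b" "C_k_on (Suc k) g {a..b}"
  shows "\<And>s. s \<in> {a..b} \<Longrightarrow> (g has_real_derivative deriv_on {a..b} g s) (at s within {a..b})"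
    and "C_k_on k (deriv_on {a..b} g) {a..b}"
proof -
  obtain g' where g': "\<forall>s\<in>{a..b}. (g has_derivative g' s) (at s within {a..b})"
    "\<forall>v. C_k_on k (\<lambda>s. g' s v) {a..b}"
    using assms(2) by auto
  have 1: "(g has_real_derivative g' s 1) (at s within {a..b})" if "s \<in> {a..b}" for s
  proof -
    have d: "(g has_derivative g' s) (at s within {a..b})" using g' that by blast
    have "g' s h = g' s 1 * h" for h
      using linear_scale[OF has_derivative_linear[OF d], of h 1] by (simp add: mult.commute)
    then have "g' s = (*) (g' s 1)" by (rule ext)
    with d show ?thesis unfolding has_field_derivative_def by simp
  qed
  then have eq: "deriv_on {a..b} g s = g' s 1" if "s \<in> {a..b}" for s
    unfolding deriv_on_def
    using vector_derivative_within_closed_interval[OF assms(1) that]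
      has_real_derivative_iff_has_vector_derivative that by blast
  show "(g has_real_derivative deriv_on {a..b} g s) (at s within {a..b})" if "s \<in> {a..b}" for s
    using 1[OF that] eq[OF that] by simp
  show "C_k_on k (deriv_on {a..b} g) {a..b}"
    using g'(2)[rule_format, of 1] by (rule C_k_on_cong) (simp add: eq)
qed

text \<open>Since \<open>p\<close> annihilates \<open>H\<close>, replacing the identity by the
  projection \<open>P\<close> does not change its Frobenius product with \<open>H\<close>, which is
  the trace. Cauchy-Schwarz then gives the factor \<open>d - 1\<close> in place of
  \<open>d\<close>.\<close>

lemma trace_square_le_of_null_vector:
  fixes H :: "'d::finite \<Rightarrow> 'd \<Rightarrow> real"
  assumes null: "\<And>i. (\<Sum>j\<in>UNIV. p j * H j i) = 0" and "p k \<noteq> 0"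
  shows "(\<Sum>i\<in>UNIV. H i i)\<^sup>2 \<le> (real CARD('d) - 1) * (\<Sum>j\<in>UNIV. \<Sum>i\<in>UNIV. (H j i)\<^sup>2)"
proof -
  define s where "s = (\<Sum>j\<in>UNIV. (p j)\<^sup>2)"
  have "s > 0" unfolding s_def
    using assms(2) by (intro sum_pos2[of UNIV k]) auto
  txt \<open>\<open>P\<close> is the orthogonal projection onto the complement of \<open>p\<close>; its squared Frobenius norm is \<open>d - 1\<close>.\<close>
  define P where "P j i = of_bool (j = i) - p j * p i / s" for j i
  have PH: "(\<Sum>j\<in>UNIV. \<Sum>i\<in>UNIV. P j i * H j i) = (\<Sum>i\<in>UNIV. H i i)"
  proof -
    have "(\<Sum>j\<in>UNIV. \<Sum>i\<in>UNIV. P j i * H j i)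
        = (\<Sum>j\<in>UNIV. \<Sum>i\<in>UNIV. of_bool (j = i) * H j i) - (\<Sum>j\<in>UNIV. \<Sum>i\<in>UNIV. p i / s * (p j * H j i))"
      by (simp add: P_def algebra_simps sum_subtractf)
    also have "(\<Sum>j\<in>UNIV. \<Sum>i\<in>UNIV. of_bool (j = i) * H j i) = (\<Sum>i\<in>UNIV. H i i)"
      by (simp add: of_bool_def if_distrib[of "\<lambda>a. a * _"] cong: if_cong)
    also have "(\<Sum>j\<in>UNIV. \<Sum>i\<in>UNIV. p i / s * (p j * H j i)) = (\<Sum>i\<in>UNIV. p i / s * (\<Sum>j\<in>UNIV. p j * H j i))"
      by (subst sum.swap) (simp add: sum_distrib_left)
    also have "\<dots> = 0" by (simp add: null)
    finally show ?thesis by simp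
  qed
  have PP: "(\<Sum>j\<in>UNIV. \<Sum>i\<in>UNIV. (P j i)\<^sup>2) = real CARD('d) - 1"
  proof -
    \<comment> \<open>Both cases in one formula: with \<open>a j = (p j)\<^sup>2 / s\<close>, the
      diagonal entries are \<open>(1 - a j)\<^sup>2\<close> and the others \<open>a j * a i\<close>.
      As the \<open>a j\<close> sum to 1, the total is \<open>(d - 2) + 1\<close>.\<close>
    have "(P j i)\<^sup>2 = of_bool (j = i) * (1 - 2 * (p j)\<^sup>2 / s) + (p j)\<^sup>2 / s * ((p i)\<^sup>2 / s)" for j i
      using \<open>s > 0\<close> by (cases "j = i") (auto simp: P_def power2_eq_square field_simps)
    then have "(\<Sum>j\<in>UNIV. \<Sum>i\<in>UNIV. (P j i)\<^sup>2)
      = (\<Sum>j\<in>UNIV. 1 - 2 * (p j)\<^sup>2 / s) + (\<Sum>j\<in>UNIV. (p j)\<^sup>2 / s) * (\<Sum>i\<in>UNIV. (p i)\<^sup>2 / s)"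
      by (simp add: sum.distrib of_bool_def if_distrib[of "\<lambda>a. a * _"] sum_product cong: if_cong)
    also have "(\<Sum>j\<in>UNIV. (p j)\<^sup>2 / s) = 1"
      using \<open>s > 0\<close> by (simp add: sum_divide_distrib[symmetric] s_def)
    also have "(\<Sum>j\<in>UNIV. 1 - 2 * (p j)\<^sup>2 / s) = real CARD('d) - 2"
      using \<open>s > 0\<close>
      by (simp add: sum_subtractf sum_divide_distrib[symmetric] sum_distrib_left[symmetric] s_def)
    finally show ?thesis by simp
  qed
  \<comment> \<open>The double sums are read as single sums over index pairs, the form in which
    Cauchy-Schwarz applies.\<close>
  have "(\<Sum>q\<in>UNIV. (case q of (j, i) \<Rightarrow> P j i) * (case q of (j, i) \<Rightarrow> H j i))\<^sup>2
      \<le> (\<Sum>q\<in>UNIV. (case q of (j, i) \<Rightarrow> P j i)\<^sup>2) * (\<Sum>q\<in>UNIV. (case q of (j, i) \<Rightarrow> H j i)\<^sup>2)"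
    by (rule Cauchy_Schwarz_ineq_sum)
  then show ?thesis
    using PH PP by (simp add: UNIV_Times_UNIV[symmetric] sum.cartesian_product[symmetric] split_def
        sum.cartesian_product' del: UNIV_Times_UNIV)
qed

text \<open>The arithmetic-geometric mean inequality for \<open>a * q\<close> and
  \<open>- c * w\<^sup>2\<close>, in squared form to avoid roots. In the application
  \<open>q\<close> is the squared Hessian norm, \<open>r\<close> the Laplacian, \<open>w\<close> the
  squared gradient and \<open>n = d - 1\<close>.\<close>

lemma quadratic_form_nonpos:
  fixes a b c n q r w :: real
  assumes "0 \<le> a" "c \<le> 0" "n / 4 * b\<^sup>2 \<le> - c * a" "r\<^sup>2 \<le> n * q" "0 \<le> q"
  shows "b * w * r + c * w\<^sup>2 \<le> a * q"
proof -
  have "(b * w * r)\<^sup>2 = (b * w)\<^sup>2 * r\<^sup>2" by (simp add: power_mult_distrib)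
  also have "\<dots> \<le> (b * w)\<^sup>2 * (n * q)" using assms(4) by (rule mult_left_mono) simp
  also have "\<dots> = 4 * w\<^sup>2 * q * (n / 4 * b\<^sup>2)" by (simp add: power_mult_distrib)
  also have "\<dots> \<le> 4 * w\<^sup>2 * q * (- c * a)" using assms(3,5) by (intro mult_left_mono) auto
  \<comment> \<open>This is \<open>4 X Y + (X - Y)\<^sup>2 = (X + Y)\<^sup>2\<close> with
    \<open>X = a * q\<close> and \<open>Y = - c * w\<^sup>2\<close>.\<close>
  also have "\<dots> \<le> 4 * w\<^sup>2 * q * (- c * a) + (a * q + c * w\<^sup>2)\<^sup>2" by simp
  also have "\<dots> = (a * q + - c * w\<^sup>2)\<^sup>2" by (simp add: power2_eq_square algebra_simps)
  finally have "(b * w * r)\<^sup>2 \<le> (a * q + - c * w\<^sup>2)\<^sup>2" .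
  moreover have "0 \<le> a * q + - c * w\<^sup>2"
    using assms(1,2,5) by (intro add_nonneg_nonneg mult_nonneg_nonneg) auto
  ultimately have "b * w * r \<le> a * q + - c * w\<^sup>2" by (rule power2_le_imp_le)
  then show ?thesis by simp
qed

text \<open>
  Only points with \<open>f s = 0\<close> need an argument: if \<open>f'' s > 0\<close> there, then \<open>f'' > 0\<close> nearby, which forces
  \<open>f = 0\<close> and hence \<open>f'' = 0\<close> on an interval.
\<close>

lemma second_derivative_nonpos_of_product:
  fixes f f' f'' :: "real \<Rightarrow> real"
  assumes "a < b"
    and d1: "\<And>s. s \<in> {a..b} \<Longrightarrow> (f has_real_derivative f' s) (at s within {a..b})"
    and d2: "\<And>s. s \<in> {a..b} \<Longrightarrow> (f' has_real_derivative f'' s) (at s within {a..b})"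
    and cont: "continuous_on {a..b} f''"
    and nonneg: "\<And>s. s \<in> {a..b} \<Longrightarrow> 0 \<le> f s"
    and prod: "\<And>s. s \<in> {a..b} \<Longrightarrow> 0 \<le> - f'' s * f s"
    and s: "s \<in> {a..b}"
  shows "f'' s \<le> 0"
proof (rule ccontr)
  assume "\<not> f'' s \<le> 0"
  then obtain d where "d > 0" and d: "\<And>x. x \<in> {a..b} \<Longrightarrow> dist x s < d \<Longrightarrow> dist (f'' x) (f'' s) < f'' s"
    using cont s unfolding continuous_on_iff by (metis not_le)
  \<comment> \<open>Clipping to \<open>{a..b}\<close> leaves a nonempty open interval even if
    \<open>s\<close> is an end point, and on it the one-sided derivatives are two-sided.\<close>
  define l where "l = max a (s - d)"
  define r where "r = min b (s + d)"
  have "l < r" using \<open>a < b\<close> \<open>d > 0\<close> s by (auto simp: l_def r_def)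
  have sub: "{l<..<r} \<subseteq> {a..b}" by (auto simp: l_def r_def)
  have pos: "f'' x > 0" if "x \<in> {l<..<r}" for x
    using d[of x] that sub by (auto simp: l_def r_def dist_real_def abs_less_iff)
  have f0: "f x = 0" if "x \<in> {l<..<r}" for x
  proof -
    have "x \<in> {a..b}" using that sub by blast
    then have "f x \<ge> 0" "f'' x * f x \<le> 0" using nonneg prod by force+
    with pos[OF that] show ?thesis by (simp add: mult_le_0_iff)
  qed
  have zero: "D = 0" if "x \<in> {l<..<r}" "\<And>y. y \<in> {l<..<r} \<Longrightarrow> g y = 0"
    "(g has_real_derivative D) (at x within {a..b})" for g x and D :: real
  proof -
    have "(g has_real_derivative D) (at x)"
      using DERIV_subset[OF that(3) sub] that(1) by (simp add: at_within_open[OF that(1)])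
    moreover have "(g has_real_derivative 0) (at x)"
      by (rule has_field_derivative_transform_within_open[of "\<lambda>_. 0", OF _ _ that(1)]) (auto simp: that(2))
    ultimately show ?thesis by (rule DERIV_unique)
  qed
  have f'0: "f' x = 0" if "x \<in> {l<..<r}" for x
    using zero[OF that f0 d1] that sub by blast
  have m: "(l + r) / 2 \<in> {l<..<r}" using \<open>l < r\<close> by simp
  then have "f'' ((l + r) / 2) = 0"
    using zero[OF m f'0 d2] sub by blast
  with pos[OF m] show False by simp
qed

section \<open>Spatial partial derivatives at a fixed time and the chain rule\<close>

lemma C_k_on_slice:
  fixes F :: "(real ^ 'd) \<times> real \<Rightarrow> real"
  assumes "C_k_on k F (UNIV \<times> T)" "t \<in> T"
  shows "C_k_on k (\<lambda>x. F (x, t)) UNIV"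
  using assms(1)
proof (induction k arbitrary: F)
  case 0
  then show ?case
    using assms(2) by (auto intro!: continuous_on_compose2[of "UNIV \<times> T" F] continuous_on_Pair)
next
  case (Suc k)
  then obtain F' where F': "\<forall>z\<in>UNIV \<times> T. (F has_derivative F' z) (at z within UNIV \<times> T)"
    "\<forall>v. C_k_on k (\<lambda>z. F' z v) (UNIV \<times> T)" by auto
  have "((\<lambda>x. F (x, t)) has_derivative (\<lambda>v. F' (x, t) (v, 0))) (at x)" for x
  proof (rule has_derivative_in_compose2[where t="UNIV \<times> T" and s=UNIV and f="\<lambda>x. (x, t)" and g=F and g'=F'])
    show "((\<lambda>x. (x, t)) has_derivative (\<lambda>v. (v, 0))) (at x)"
      by (auto intro!: derivative_eq_intros)
  qed (use F' assms(2) in auto)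
  moreover have "C_k_on k (\<lambda>x. F' (x, t) (v, 0)) UNIV" for v
    using Suc.IH F'(2) by blast
  ultimately show ?case
    unfolding C_k_on.simps(2) by (intro exI[of _ "\<lambda>x v. F' (x, t) (v, 0)"]) simp
qed

lemma partial_eq_ddir: "partial i = ddir (axis i 1)"
  by (simp add: partial_def ddir_def fun_eq_iff)

lemma C_k_on_partial: "C_k_on (Suc k) v UNIV \<Longrightarrow> C_k_on k (partial i v) UNIV"
  unfolding partial_eq_ddir by (rule C_k_on_ddir) auto

lemma DERIV_partial:
  "C_k_on (Suc k) v UNIV \<Longrightarrow> DERIV (\<lambda>h. v (x + h *\<^sub>R axis i 1)) s :> partial i v (x + s *\<^sub>R axis i 1)"
  unfolding partial_eq_ddir by (rule C_k_on_open_DERIV) auto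

lemma partial_unique: "DERIV (\<lambda>h. f (x + h *\<^sub>R axis i 1)) 0 :> D \<Longrightarrow> partial i f x = D"
  unfolding partial_eq_ddir by (rule ddir_unique)

lemma partial_commute:
  assumes "C_k_on (Suc (Suc k)) v UNIV"
  shows "partial i (partial j v) = partial j (partial i v)"
proof
  have "C_k_on 2 v UNIV"
    using assms by (rule C_k_on_mono) simp
  show "partial i (partial j v) x = partial j (partial i v) x" for x
    unfolding partial_eq_ddir using \<open>C_k_on 2 v UNIV\<close> by (intro ddir_commute[of v UNIV]) auto
qed

text \<open>\<open>g\<close> is differentiable only relative to \<open>I\<close>, one-sidedly at its
  end points. This suffices because \<open>v\<close> takes its values in \<open>I\<close>.\<close>

lemma DERIV_comp_partial:
  fixes v :: "real ^ 'd \<Rightarrow> real"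
  assumes g: "\<And>s. s \<in> I \<Longrightarrow> (g has_real_derivative g' s) (at s within I)"
    and v: "C_k_on (Suc k) v UNIV" "\<And>x. v x \<in> I"
  shows "DERIV (\<lambda>h. g (v (x + h *\<^sub>R axis i 1))) s
    :> g' (v (x + s *\<^sub>R axis i 1)) * partial i v (x + s *\<^sub>R axis i 1)"
proof -
  have "(g has_real_derivative g' (v (x + s *\<^sub>R axis i 1)))
      (at (v (x + s *\<^sub>R axis i 1)) within range (\<lambda>h. v (x + h *\<^sub>R axis i 1)))"
    using g[OF v(2)] by (rule DERIV_subset) (use v(2) in auto)
  from DERIV_image_chain[OF this DERIV_partial[OF v(1)]] show ?thesis by (simp add: o_def)
qed

lemma laplacian_comp:
  fixes v :: "real ^ 'd \<Rightarrow> real"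
  assumes g: "\<And>s. s \<in> I \<Longrightarrow> (g has_real_derivative g1 s) (at s within I)"
    and g1: "\<And>s. s \<in> I \<Longrightarrow> (g1 has_real_derivative g2 s) (at s within I)"
    and v: "C_k_on (Suc (Suc k)) v UNIV" "\<And>x. v x \<in> I"
  shows "laplacian (\<lambda>y. g (v y)) x
    = g1 (v x) * laplacian v x + g2 (v x) * (\<Sum>i\<in>UNIV. (partial i v x)\<^sup>2)"
proof -
  have p: "partial i (\<lambda>y. g (v y)) = (\<lambda>x. g1 (v x) * partial i v x)" for i
    using partial_unique[OF DERIV_comp_partial[OF g v, where s=0]] by (auto simp: fun_eq_iff)
  have "partial i (partial i (\<lambda>y. g (v y))) x
      = g2 (v x) * partial i v x * partial i v x + partial i (partial i v) x * g1 (v x)" for i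
    unfolding p
    using DERIV_mult[OF DERIV_comp_partial[OF g1 v, of x i 0] DERIV_partial[OF C_k_on_partial[OF v(1)], of i x i 0]]
    by (intro partial_unique) simp
  then show ?thesis
    by (simp add: laplacian_def sum.distrib sum_distrib_left power2_eq_square mult.assoc mult.commute[of "g1 (v x)"])
qed

section \<open>Signs at a spatial maximum of the squared gradient and of the solution\<close>

text \<open>For a solution, \<open>q j\<close> is the time derivative of \<open>partial j v\<close>,
  so the conclusion concerns half the time derivative of the squared gradient.\<close>

lemma bernstein_at_maximum:
  fixes v :: "real ^ 'd \<Rightarrow> real"
  assumes G: "\<And>s. s \<in> I \<Longrightarrow> (G has_real_derivative g1 s) (at s within I)"
    and g1: "\<And>s. s \<in> I \<Longrightarrow> (g1 has_real_derivative g2 s) (at s within I)"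
    and g2: "\<And>s. s \<in> I \<Longrightarrow> (g2 has_real_derivative g3 s) (at s within I)"
    and g1_nonneg: "\<And>s. s \<in> I \<Longrightarrow> 0 \<le> g1 s"
    and g3_nonpos: "\<And>s. s \<in> I \<Longrightarrow> g3 s \<le> 0"
    and struct: "\<And>s. s \<in> I \<Longrightarrow> (real CARD('d) - 1) / 4 * (g2 s)\<^sup>2 \<le> - g3 s * g1 s"
    and v: "C_k_on 3 v UNIV" "\<And>x. v x \<in> I"
    and mx: "\<And>y. (\<Sum>j\<in>UNIV. (partial j v y)\<^sup>2) \<le> (\<Sum>j\<in>UNIV. (partial j v x)\<^sup>2)"
    and q: "\<And>j. DERIV (\<lambda>h. laplacian (\<lambda>y. G (v y)) (x + h *\<^sub>R axis j 1)) 0 :> q j"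
  shows "(\<Sum>j\<in>UNIV. partial j v x * q j) \<le> 0"
proof (cases "\<exists>k. partial k v x \<noteq> 0")
  case False
  then show ?thesis by simp
next
  case True
  then obtain k0 where k0: "partial k0 v x \<noteq> 0" by blast
  have v3: "C_k_on (Suc (Suc (Suc 0))) v UNIV" using v(1) by (simp only: numeral_3_eq_3)
  have v2: "C_k_on (Suc (Suc 0)) (partial j v) UNIV" for j by (rule C_k_on_partial[OF v3])
  have v1: "C_k_on (Suc 0) (partial i (partial j v)) UNIV" for i j by (rule C_k_on_partial[OF v2])
  define H where "H j i = partial i (partial j v)" for j i
  define T where "T j i = partial i (partial i (partial j v)) x" for j i
  have dp: "DERIV (\<lambda>h. partial j v (y + h *\<^sub>R axis i 1)) s :> H j i (y + s *\<^sub>R axis i 1)" for j i y s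
    unfolding H_def by (rule DERIV_partial[OF v2])
  have dH: "DERIV (\<lambda>h. H j i (x + h *\<^sub>R axis k 1)) 0 :> partial k (H j i) x" for j i k
    using DERIV_partial[OF v1, of i j x k 0] by (simp add: H_def)
  \<comment> \<open>The third derivatives arise in two orders: from differentiating the Laplacian,
    and from the second derivatives of the squared gradient. Symmetry identifies them.\<close>
  have T_eq: "partial j (H i i) x = T j i" for i j
  proof -
    have "partial j (partial i (partial i v)) = partial i (partial j (partial i v))"
      by (rule partial_commute[OF v2])
    also have "partial j (partial i v) = partial i (partial j v)"
      by (rule partial_commute[OF v3])
    finally show ?thesis by (simp add: H_def T_def)
  qed
  define w where "w = (\<Sum>j\<in>UNIV. (partial j v x)\<^sup>2)"
  have dw1: "DERIV (\<lambda>h. \<Sum>j\<in>UNIV. (partial j v (x + h *\<^sub>R axis k 1))\<^sup>2) s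
      :> (\<Sum>j\<in>UNIV. 2 * (partial j v (x + s *\<^sub>R axis k 1) * H j k (x + s *\<^sub>R axis k 1)))" for k s
    by (rule derivative_eq_intros dp refl | simp add: mult_ac)+
  have dw2: "DERIV (\<lambda>s. \<Sum>j\<in>UNIV. 2 * (partial j v (x + s *\<^sub>R axis k 1) * H j k (x + s *\<^sub>R axis k 1))) 0
      :> (\<Sum>j\<in>UNIV. 2 * ((H j k x)\<^sup>2 + partial j v x * T j k))" for k
  proof (rule DERIV_sum)
    fix j
    have "partial k (H j k) x = T j k" by (simp add: H_def T_def)
    with DERIV_cmult[OF DERIV_mult[OF dp[of j x k 0] dH[of j k k]], of 2]
    show "DERIV (\<lambda>s. 2 * (partial j v (x + s *\<^sub>R axis k 1) * H j k (x + s *\<^sub>R axis k 1))) 0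
      :> 2 * ((H j k x)\<^sup>2 + partial j v x * T j k)"
      by (simp add: power2_eq_square algebra_simps)
  qed
  \<comment> \<open>First- and second-order conditions for the squared gradient along the
    \<open>k\<close>-th coordinate line. The first says that the gradient is a null vector of the
    Hessian; the second, summed over \<open>k\<close>, becomes \<open>third\<close>.\<close>
  have "(\<Sum>j\<in>UNIV. 2 * (partial j v x * H j k x)) = 0"
    and snd: "(\<Sum>j\<in>UNIV. 2 * ((H j k x)\<^sup>2 + partial j v x * T j k)) \<le> 0" for k
    using DERIV_local_max_second[OF dw1 dw2] mx by auto
  then have null: "(\<Sum>j\<in>UNIV. partial j v x * H j k x) = 0" for k
    by (simp add: sum_distrib_left[symmetric])
  define Q where "Q = (\<Sum>j\<in>UNIV. \<Sum>i\<in>UNIV. (H j i x)\<^sup>2)"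
  define L where "L = (\<Sum>i\<in>UNIV. H i i x)"
  have "Q \<ge> 0" unfolding Q_def by (intro sum_nonneg) auto
  have L2: "L\<^sup>2 \<le> (real CARD('d) - 1) * Q"
    unfolding L_def Q_def using trace_square_le_of_null_vector[OF null k0] .
  have third: "(\<Sum>j\<in>UNIV. \<Sum>i\<in>UNIV. partial j v x * T j i) \<le> - Q"
  proof -
    have "(\<Sum>j\<in>UNIV. (H j k x)\<^sup>2) + (\<Sum>j\<in>UNIV. partial j v x * T j k) \<le> 0" for k
      using snd[of k] by (simp add: sum_distrib_left[symmetric] sum.distrib)
    then have "(\<Sum>k\<in>UNIV. (\<Sum>j\<in>UNIV. (H j k x)\<^sup>2) + (\<Sum>j\<in>UNIV. partial j v x * T j k)) \<le> 0"
      by (intro sum_nonpos) auto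
    then have "(\<Sum>k\<in>UNIV. \<Sum>j\<in>UNIV. (H j k x)\<^sup>2) + (\<Sum>k\<in>UNIV. \<Sum>j\<in>UNIV. partial j v x * T j k) \<le> 0"
      by (simp add: sum.distrib)
    then show ?thesis
      unfolding Q_def
      by (subst sum.swap, subst (2) sum.swap) simp
  qed
  have lap: "laplacian (\<lambda>y. G (v y)) y
      = g1 (v y) * (\<Sum>i\<in>UNIV. H i i y) + g2 (v y) * (\<Sum>i\<in>UNIV. (partial i v y)\<^sup>2)" for y
    using laplacian_comp[OF G g1 v3 v(2)] by (simp add: laplacian_def H_def)
  have q_eq: "q j = partial j v x * (g2 (v x) * L + g3 (v x) * w) + g1 (v x) * (\<Sum>i\<in>UNIV. T j i)
      + g2 (v x) * (\<Sum>i\<in>UNIV. 2 * (partial i v x * H i j x))" for j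
  proof (rule DERIV_unique[OF q])
    have dL: "DERIV (\<lambda>h. \<Sum>i\<in>UNIV. H i i (x + h *\<^sub>R axis j 1)) 0 :> (\<Sum>i\<in>UNIV. T j i)"
      by (rule DERIV_sum) (use dH T_eq in metis)
    have dg1: "DERIV (\<lambda>h. g1 (v (x + h *\<^sub>R axis j 1))) 0 :> g2 (v x) * partial j v x"
      using DERIV_comp_partial[OF g1 v3 v(2), of x j 0] by simp
    have dg2: "DERIV (\<lambda>h. g2 (v (x + h *\<^sub>R axis j 1))) 0 :> g3 (v x) * partial j v x"
      using DERIV_comp_partial[OF g2 v3 v(2), of x j 0] by simp
    have dw: "DERIV (\<lambda>h. \<Sum>i\<in>UNIV. (partial i v (x + h *\<^sub>R axis j 1))\<^sup>2) 0
        :> (\<Sum>i\<in>UNIV. 2 * (partial i v x * H i j x))"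
      using dw1[of j 0] by simp
    show "DERIV (\<lambda>h. laplacian (\<lambda>y. G (v y)) (x + h *\<^sub>R axis j 1)) 0
      :> partial j v x * (g2 (v x) * L + g3 (v x) * w) + g1 (v x) * (\<Sum>i\<in>UNIV. T j i)
      + g2 (v x) * (\<Sum>i\<in>UNIV. 2 * (partial i v x * H i j x))"
      unfolding lap
      using DERIV_add[OF DERIV_mult[OF dg1 dL] DERIV_mult[OF dg2 dw]]
      by (simp add: L_def w_def algebra_simps)
  qed
  \<comment> \<open>With the factor 2 outside, the last sum is exactly the one that
    \<open>null\<close> makes vanish.\<close>
  have q_simp: "q j = partial j v x * (g2 (v x) * L + g3 (v x) * w) + g1 (v x) * (\<Sum>i\<in>UNIV. T j i)
      + g2 (v x) * 2 * (\<Sum>i\<in>UNIV. partial i v x * H i j x)" for j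
    unfolding q_eq by (simp add: sum_distrib_left mult.assoc)
  have "(\<Sum>j\<in>UNIV. partial j v x * q j)
      = (\<Sum>j\<in>UNIV. (partial j v x)\<^sup>2 * (g2 (v x) * L + g3 (v x) * w)
          + g1 (v x) * (\<Sum>i\<in>UNIV. partial j v x * T j i))"
  proof (rule sum.cong)
    fix j
    have "(\<Sum>i\<in>UNIV. partial j v x * T j i) = partial j v x * (\<Sum>i\<in>UNIV. T j i)"
      by (simp only: sum_distrib_left)
    then show "partial j v x * q j = (partial j v x)\<^sup>2 * (g2 (v x) * L + g3 (v x) * w)
        + g1 (v x) * (\<Sum>i\<in>UNIV. partial j v x * T j i)"
      by (simp add: q_simp null power2_eq_square algebra_simps)
  qed simp
  also have "\<dots> = w * (g2 (v x) * L + g3 (v x) * w)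
      + g1 (v x) * (\<Sum>j\<in>UNIV. \<Sum>i\<in>UNIV. partial j v x * T j i)"
    by (simp add: sum.distrib sum_distrib_left sum_distrib_right w_def)
  also have "\<dots> \<le> w * (g2 (v x) * L + g3 (v x) * w) + g1 (v x) * - Q"
    using third g1_nonneg[OF v(2)] by (intro add_left_mono mult_left_mono)
  also have "\<dots> = (g2 (v x) * w * L + g3 (v x) * w\<^sup>2) - g1 (v x) * Q"
    by (simp add: power2_eq_square algebra_simps)
  also have "\<dots> \<le> 0"
    using quadratic_form_nonpos[OF g1_nonneg[OF v(2)] g3_nonpos[OF v(2)] struct[OF v(2)] L2 \<open>Q \<ge> 0\<close>, of x w]
    by simp
  finally show ?thesis .
qed

text \<open>At an extremum the gradient vanishes, so only the term with \<open>g1\<close> survives,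
  and it has the sign of the pure second derivatives. The factor \<open>\<sigma>\<close> treats
  maxima and minima together.\<close>

lemma laplacian_comp_nonpos_at_maximum:
  fixes v :: "real ^ 'd \<Rightarrow> real"
  assumes G: "\<And>s. s \<in> I \<Longrightarrow> (G has_real_derivative g1 s) (at s within I)"
    and g1: "\<And>s. s \<in> I \<Longrightarrow> (g1 has_real_derivative g2 s) (at s within I)"
    and g1_nonneg: "\<And>s. s \<in> I \<Longrightarrow> 0 \<le> g1 s"
    and v: "C_k_on 2 v UNIV" "\<And>x. v x \<in> I"
    and \<sigma>: "\<And>y. \<sigma> * v y \<le> \<sigma> * v x"
  shows "\<sigma> * laplacian (\<lambda>y. G (v y)) x \<le> 0"
proof (cases "\<sigma> = 0")
  case False
  have v2: "C_k_on (Suc (Suc 0)) v UNIV" using v(1) by (simp only: numeral_2_eq_2)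
  have 1: "DERIV (\<lambda>h. \<sigma> * v (x + h *\<^sub>R axis i 1)) s :> \<sigma> * partial i v (x + s *\<^sub>R axis i 1)" for i s
    by (intro DERIV_cmult DERIV_partial[OF v2])
  have 2: "DERIV (\<lambda>h. \<sigma> * partial i v (x + h *\<^sub>R axis i 1)) 0 :> \<sigma> * partial i (partial i v) x" for i
    using DERIV_cmult[OF DERIV_partial[OF C_k_on_partial[OF v2], of i x i 0], of \<sigma>] by simp
  have "\<sigma> * partial i v x = 0" "\<sigma> * partial i (partial i v) x \<le> 0" for i
    using DERIV_local_max_second[OF 1 2, of i] \<sigma> by auto
  with False have p: "partial i v x = 0" "\<sigma> * partial i (partial i v) x \<le> 0" for i by auto
  have "\<sigma> * laplacian (\<lambda>y. G (v y)) x = g1 (v x) * (\<Sum>i\<in>UNIV. \<sigma> * partial i (partial i v) x)"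
    using laplacian_comp[OF G g1 v2 v(2), of x] p(1)
    by (simp add: laplacian_def sum_distrib_left mult_ac)
  also have "\<dots> \<le> 0"
    using p(2) by (intro mult_nonneg_nonpos[OF g1_nonneg[OF v(2)]] sum_nonpos) auto
  finally show ?thesis .
qed simp

lemma torus_periodic_partial:
  assumes "torus_periodic f" shows "torus_periodic (partial i f)"
  unfolding torus_periodic_def partial_def
proof (intro allI)
  fix x j
  have "f (x + axis j 1 + h *\<^sub>R axis i 1) = f (x + h *\<^sub>R axis i 1)" for h :: real
    using assms unfolding torus_periodic_def by (metis add.assoc add.commute)
  then show "deriv (\<lambda>h. f (x + axis j 1 + h *\<^sub>R axis i 1)) 0 = deriv (\<lambda>h. f (x + h *\<^sub>R axis i 1)) 0"
    by simp
qed

section \<open>Bounds on the solution and its gradient by the initial data\<close>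

theorem corollary1p4:
  fixes lo hi M :: real
    and G :: "real \<Rightarrow> real"
    and u :: "real ^ 'd \<Rightarrow> real \<Rightarrow> real"
    and u0 :: "real ^ 'd \<Rightarrow> real"
  assumes lo_hi: "lo < hi"
    and G_C3: "C_k_on 3 G {lo..hi}"
    and G_nondecreasing: "\<forall>s\<in>{lo..hi}. deriv_on {lo..hi} G s \<ge> 0"
    and G_structure: "\<forall>s\<in>{lo..hi}.
          (real CARD('d) - 1) / 4 * ((deriv_on {lo..hi} ^^ 2) G s)\<^sup>2
            \<le> - (deriv_on {lo..hi} ^^ 3) G s * deriv_on {lo..hi} G s"
    and u_periodic: "\<forall>t\<ge>0. torus_periodic (\<lambda>x. u x t)"
    and u_C3: "C_k_on 3 (\<lambda>(x, t). u x t) (UNIV \<times> {0..})"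
    and pde: "\<forall>x. \<forall>t>0. deriv (u x) t = laplacian (\<lambda>y. G (u y t)) x"
    and init: "\<forall>x. u x 0 = u0 x"
    and M_pos: "M > 0"
    and u_bounds: "\<forall>t\<ge>0. \<forall>x. lo \<le> u x t \<and> u x t \<le> hi"
    and Du_bound: "\<forall>t\<ge>0. grad_sup_norm (\<lambda>x. u x t) \<le> M"
  shows "\<forall>t\<ge>0. (\<forall>x. (INF y. u0 y) \<le> u x t \<and> u x t \<le> (SUP y. u0 y))
            \<and> grad_sup_norm (\<lambda>x. u x t) \<le> grad_sup_norm u0"
proof -
  define I where "I = {lo..hi}"
  define g1 where "g1 = deriv_on I G"
  define g2 where "g2 = deriv_on I g1"
  define g3 where "g3 = deriv_on I g2"
  have "C_k_on (Suc (Suc (Suc 0))) G {lo..hi}" using G_C3 by (simp only: numeral_3_eq_3)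
  note G' = deriv_on_Icc[OF lo_hi this, folded I_def g1_def]
  note g1' = deriv_on_Icc[OF lo_hi G'(2)[unfolded I_def], folded I_def g2_def]
  note g2' = deriv_on_Icc[OF lo_hi g1'(2)[unfolded I_def], folded I_def g3_def]
  have g1_nonneg: "0 \<le> g1 s" if "s \<in> I" for s
    using G_nondecreasing that by (simp add: g1_def I_def)
  have struct: "(real CARD('d) - 1) / 4 * (g2 s)\<^sup>2 \<le> - g3 s * g1 s" if "s \<in> I" for s
    using G_structure that
    by (simp add: g1_def g2_def g3_def I_def numeral_2_eq_2 numeral_3_eq_3)
  have card: "1 \<le> real CARD('d)"
    by (simp add: Suc_leI)
  \<comment> \<open>As \<open>d \<ge> 1\<close>, the structure condition gives a sign only to the
    product of \<open>g3\<close> and \<open>g1\<close>; zeros of \<open>g1\<close> are covered by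
    the lemma on products.\<close>
  have g3_nonpos: "g3 s \<le> 0" if "s \<in> I" for s
  proof (rule second_derivative_nonpos_of_product[OF lo_hi, of g1 g2 g3 s, folded I_def])
    show "0 \<le> - g3 s * g1 s" if "s \<in> I" for s
    proof -
      have "0 \<le> (real CARD('d) - 1) / 4 * (g2 s)\<^sup>2"
        using card by (intro mult_nonneg_nonneg) auto
      with struct[OF that] show ?thesis by linarith
    qed
    show "continuous_on I g3" using g2'(2) by simp
  qed (use g1' g2' g1_nonneg that in auto)
  define U where "U = (\<lambda>(x, t). u x t)"
  \<comment> \<open>The closed set \<open>S\<close> gives continuity up to time 0; its open part
    \<open>\<Omega>\<close> admits time derivatives and their exchange with spatial ones.\<close>
  define S where "S = (UNIV :: (real ^ 'd) set) \<times> {0::real..}"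
  define \<Omega> where "\<Omega> = (UNIV :: (real ^ 'd) set) \<times> {0::real<..}"
  have "open \<Omega>" unfolding \<Omega>_def by (intro open_Times) auto
  have U3S: "C_k_on (Suc (Suc (Suc 0))) U S"
    using u_C3 by (simp only: numeral_3_eq_3 U_def S_def)
  have U3: "C_k_on (Suc (Suc (Suc 0))) U \<Omega>"
    by (rule C_k_on_subset[OF U3S]) (auto simp: S_def \<Omega>_def)
  have space: "C_k_on 3 (\<lambda>x. u x t) UNIV" if "t \<ge> 0" for t
    using C_k_on_slice[OF u_C3, of t] that by simp
  have uI: "u x t \<in> I" if "t \<ge> 0" for x t
    using u_bounds that by (simp add: I_def)
  have partial_U: "partial j (\<lambda>y. u y t) x = ddir (axis j 1, 0) U (x, t)" for j x t
    by (simp add: partial_def ddir_def U_def)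
  have ev\<Omega>: "eventually (\<lambda>h. z + h *\<^sub>R w \<in> \<Omega>) (nhds 0)" if "z \<in> \<Omega>" for z w
    using eventually_line_in_open[OF \<open>open \<Omega>\<close> that] .
  have time: "DERIV (\<lambda>s. F (x, s)) t :> ddir (0, 1) F (x, t)"
    if "C_k_on (Suc k) F \<Omega>" "t > 0" for F k x t
    using C_k_on_open_DERIV[OF that(1) \<open>open \<Omega>\<close>, of "(x, 0)" t "(0, 1)"] that(2) by (simp add: \<Omega>_def)
  \<comment> \<open>\<open>deriv\<close> is total, so the equation by itself does not assert
    differentiability in time; that comes from the regularity of \<open>U\<close>.\<close>
  have u_t: "DERIV (u x) t :> laplacian (\<lambda>y. G (u y t)) x" if "t > 0" for x t
  proof -
    have "DERIV (u x) t :> ddir (0, 1) U (x, t)"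
      using time[OF U3 that] by (simp add: U_def)
    with pde that show ?thesis using DERIV_imp_deriv by fastforce
  qed
  have cont_U: "continuous_on S U" by (rule C_k_on_imp_continuous_on[OF U3S])
  \<comment> \<open>The values 1 and -1 of \<open>\<sigma>\<close> yield the upper and the lower
    bound.\<close>
  have sup_inf: "\<exists>y. \<forall>t\<ge>0. \<forall>x. \<sigma> * u x t \<le> \<sigma> * u y 0" for \<sigma>
  proof (rule parabolic_maximum_principle)
    show "torus_periodic (\<lambda>x. \<sigma> * u x t)" if "t \<ge> 0" for t
      using u_periodic that by (simp add: torus_periodic_def)
    show "continuous_on (UNIV \<times> {0..}) (\<lambda>(x, t). \<sigma> * u x t)"
      using continuous_on_mult_left[OF cont_U, of \<sigma>] by (simp add: S_def U_def case_prod_unfold)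
    show "\<exists>D\<le>0. DERIV (\<lambda>t. \<sigma> * u x t) t :> D" if "t > 0" "\<And>y. \<sigma> * u y t \<le> \<sigma> * u x t" for x t
    proof (intro exI conjI)
      show "DERIV (\<lambda>t. \<sigma> * u x t) t :> \<sigma> * laplacian (\<lambda>y. G (u y t)) x"
        by (intro DERIV_cmult u_t that(1))
      show "\<sigma> * laplacian (\<lambda>y. G (u y t)) x \<le> 0"
        using that C_k_on_mono[OF space, of t 2] uI[of t]
        by (intro laplacian_comp_nonpos_at_maximum[OF G'(1) g1'(1) g1_nonneg]) auto
    qed
  qed
  \<comment> \<open>The square keeps this differentiable in time where the gradient
    vanishes.\<close>
  define W where "W x t = (\<Sum>j\<in>UNIV. (partial j (\<lambda>y. u y t) x)\<^sup>2)" for x t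
  have W_max: "\<exists>y. \<forall>t\<ge>0. \<forall>x. W x t \<le> W y 0"
  proof (rule parabolic_maximum_principle)
    show "torus_periodic (\<lambda>x. W x t)" if "t \<ge> 0" for t
      using torus_periodic_partial[of "\<lambda>y. u y t"] u_periodic that
      by (simp add: torus_periodic_def W_def)
    have "continuous_on S (ddir (axis j 1, 0) U)" for j
      by (intro C_k_on_imp_continuous_on[OF C_k_on_ddir[OF U3S]]) (auto simp: S_def)
    then have "continuous_on S (\<lambda>z. \<Sum>j\<in>UNIV. (ddir (axis j 1, 0) U z)\<^sup>2)"
      by (intro continuous_intros)
    then show "continuous_on (UNIV \<times> {0..}) (\<lambda>(x, t). W x t)"
      by (simp add: W_def partial_U S_def case_prod_unfold)
    show "\<exists>D\<le>0. DERIV (W x) t :> D" if t: "t > 0" and mx: "\<And>y. W y t \<le> W x t" for x t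
    proof (intro exI conjI)
      let ?q = "\<lambda>j. ddir (0, 1) (ddir (axis j 1, 0) U) (x, t)"
      have dt: "DERIV (\<lambda>s. partial j (\<lambda>y. u y s) x) t :> ?q j" for j
        unfolding partial_U by (rule time[OF C_k_on_ddir[OF U3 ev\<Omega>] t])
      show "DERIV (W x) t :> 2 * (\<Sum>j\<in>UNIV. partial j (\<lambda>y. u y t) x * ?q j)"
        unfolding W_def sum_distrib_left
        by (rule derivative_eq_intros dt refl | simp add: mult_ac)+
      \<comment> \<open>The equation differentiated in space: it holds on the whole slice at time
        \<open>t\<close>, and Schwarz's theorem exchanges the time derivative with the spatial
        one.\<close>
      have "DERIV (\<lambda>h. laplacian (\<lambda>y. G (u y t)) (x + h *\<^sub>R axis j 1)) 0 :> ?q j" for j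
      proof -
        have U2: "C_k_on 2 U \<Omega>" by (rule C_k_on_mono[OF U3]) simp
        have xt: "(x, t) \<in> \<Omega>" using t by (simp add: \<Omega>_def)
        have "DERIV (\<lambda>h. ddir (0, 1) U ((x, t) + h *\<^sub>R (axis j 1, 0))) 0
            :> ddir (axis j 1, 0) (ddir (0, 1) U) (x, t)"
          by (rule C_k_on_Suc_DERIV_ddir[OF C_k_on_ddir[OF U3 ev\<Omega>] xt ev\<Omega>[OF xt]])
        moreover have "ddir (0, 1) U (y, t) = laplacian (\<lambda>y. G (u y t)) y" for y
          using DERIV_unique[OF _ u_t[OF t, of y]] time[OF U3 t, of y] by (simp add: U_def)
        ultimately show ?thesis
          using ddir_commute[OF U2 \<open>open \<Omega>\<close> xt, of "(0, 1)" "(axis j 1, 0)"] by simp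
      qed
      then have "(\<Sum>j\<in>UNIV. partial j (\<lambda>y. u y t) x * ?q j) \<le> 0"
        using t mx space[of t] uI[of t] unfolding W_def
        by (intro bernstein_at_maximum[OF G'(1) g1'(1) g2'(1) g1_nonneg g3_nonpos struct]) auto
      then show "2 * (\<Sum>j\<in>UNIV. partial j (\<lambda>y. u y t) x * ?q j) \<le> 0" by simp
    qed
  qed
  have u0: "u0 = (\<lambda>x. u x 0)" using init by auto
  have W_norm: "norm (gradient (\<lambda>y. u y t) x) = sqrt (W x t)" for x t
    by (simp add: norm_vec_def L2_set_def gradient_def W_def)
  obtain y1 where y1: "\<And>t x. t \<ge> 0 \<Longrightarrow> u x t \<le> u y1 0"
    using sup_inf[of 1] by auto
  obtain y2 where y2: "\<And>t x. t \<ge> 0 \<Longrightarrow> u y2 0 \<le> u x t"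
    using sup_inf[of "-1"] by auto
  obtain y3 where y3: "\<And>t x. t \<ge> 0 \<Longrightarrow> norm (gradient (\<lambda>y. u y t) x) \<le> norm (gradient u0 y3)"
    using W_max by (auto simp: u0 W_norm)
  show ?thesis
  proof (intro allI impI conjI)
    fix t x assume t: "(t::real) \<ge> 0"
    \<comment> \<open>The bounds by attained values, taken at time 0, supply the boundedness that
      makes the real supremum and infimum meaningful.\<close>
    have "bdd_above (range u0)" "bdd_below (range u0)"
      using y1[of 0] y2[of 0] by (auto simp: u0 bdd_above_def bdd_below_def)
    then have "u0 y1 \<le> (SUP y. u0 y)" "(INF y. u0 y) \<le> u0 y2"
      by (auto intro: cSUP_upper cINF_lower)
    with y1[OF t] y2[OF t] init show "(INF y. u0 y) \<le> u x t" "u x t \<le> (SUP y. u0 y)"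
      by (metis order_trans)+
  next
    fix t assume t: "(t::real) \<ge> 0"
    have "norm (gradient u0 x) \<le> norm (gradient u0 y3)" for x
      using y3[of 0 x] by (simp add: u0)
    then have "bdd_above (range (\<lambda>x. norm (gradient u0 x)))" by (auto simp: bdd_above_def)
    then have "norm (gradient u0 y3) \<le> grad_sup_norm u0"
      unfolding grad_sup_norm_def by (intro cSUP_upper) auto
    then show "grad_sup_norm (\<lambda>x. u x t) \<le> grad_sup_norm u0"
      unfolding grad_sup_norm_def[of "\<lambda>x. u x t"]
      using y3[OF t] by (intro cSUP_least) (auto intro: order_trans)
  qed
qed

end
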